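(* Let $n\ge2$. The poset $P_n$ of endgame moves is a symmetric modular lattice: it is a modular lattice (with rank function $\rho((i,j))=\mathrm{level}(i)+2j$, one has $\rho(x)+\rho(y)=\rho(x\vee y)+\rho(x\wedge y)$ for all $x,y\in P_n$), the map $(i,j)\mapsto(i',j)$ with $i'=2^{\mathrm{level}(i)}+2^{\mathrm{level}(i)-1}-1-i$ is an automorphism of $P_n$, and the map $(i,j)\mapsto(i,\,n-1-\mathrm{level}(i)-j)$ is an anti-automorphism of $P_n$.
   Context: Setting: the infinite binary tree with nodes labeled by positive integers (root $1$; node $i$ has left child $2i$, right child $2i+1$, parent $\lfloor i/2\rfloor$ for $i>1$), with a self-loop at the root; $\mathrm{level}(i)=\lfloor\log_2 i\rfloor+1$. Labeled chip-firing: a node holding at least $3$ chips may fire any $3$ of them, sending the smallest to its left child, the largest to its right child and the middle one to its parent (the root keeps it). Start with $2^n-1$ chips labeled $1,\dots,2^n-1$ at the root; a complete firing sequence is a finite sequence of legal firings ending in a configuration where no node holds $3$ or more chips. In every complete firing sequence each node fires the same number of times; $(i,j)$ denotes the $(j+1)$-th-to-last firing of node $i$ ($j\ge0$). $P_n$ is the set of moves $(i,j)$ with $\mathrm{level}(i)+j<n$, partially ordered by $(i_2,j_2)\le(i_1,j_1)$ if and only if in every complete firing sequence $(i_1,j_1)$ does not occur after $(i_2,j_2)$. The word "symmetric" is understood as the existence of the stated left-right automorphism and top-bottom anti-automorphism. *)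

theory Defs
  imports Complex_Main "HOL-Algebra.Lattice"
begin

definition level :: "nat \<Rightarrow> nat" where
  "level i = nat \<lfloor>log 2 (real i)\<rfloor> + 1"

definition parent :: "nat \<Rightarrow> nat" where
  "parent i = (if i = 1 then 1 else i div 2)"

definition chips :: "nat \<Rightarrow> nat set" where
  "chips n = {1 .. 2 ^ n - 1}"

text \<open>
  A configuration maps each chip label to the node holding that chip; only its values on
  \<^term>\<open>chips n\<close> matter.  A firing \<open>(i, a, b, c)\<close> is node \<open>i\<close> firing the chips \<open>a < b < c\<close>.
\<close>

type_synonym config = "nat \<Rightarrow> nat"
type_synonym firing = "nat \<times> nat \<times> nat \<times> nat"

fun legal :: "nat \<Rightarrow> config \<Rightarrow> firing \<Rightarrow> bool" where
  "legal n C (i, a, b, c) \<longleftrightarrow>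
     {a, b, c} \<subseteq> chips n \<and> a < b \<and> b < c \<and> C a = i \<and> C b = i \<and> C c = i"

fun fire :: "firing \<Rightarrow> config \<Rightarrow> config" where
  "fire (i, a, b, c) C = C(a := 2 * i, b := parent i, c := 2 * i + 1)"

definition stable :: "nat \<Rightarrow> config \<Rightarrow> bool" where
  "stable n C \<longleftrightarrow> (\<forall>i. card {c \<in> chips n. C c = i} < 3)"

fun completes :: "nat \<Rightarrow> config \<Rightarrow> firing list \<Rightarrow> bool" where
  "completes n C [] \<longleftrightarrow> stable n C"
| "completes n C (f # fs) \<longleftrightarrow> legal n C f \<and> completes n (fire f C) fs"

definition complete_firing_sequence :: "nat \<Rightarrow> firing list \<Rightarrow> bool" where
  "complete_firing_sequence n fs \<longleftrightarrow> completes n (\<lambda>_. 1) fs"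

text \<open>
  The move \<open>(i, j)\<close> occurs at position \<open>t\<close> of \<open>fs\<close> if node \<open>i\<close> fires at position \<open>t\<close> and exactly
  \<open>j\<close> times afterwards, i.e. if this is the \<open>(j + 1)\<close>-th-to-last firing of \<open>i\<close>.
\<close>

type_synonym move = "nat \<times> nat"

fun occurs_at :: "firing list \<Rightarrow> move \<Rightarrow> nat \<Rightarrow> bool" where
  "occurs_at fs (i, j) t \<longleftrightarrow>
     t < length fs \<and> fst (fs ! t) = i \<and>
     card {u. t < u \<and> u < length fs \<and> fst (fs ! u) = i} = j"

definition occurs_after :: "firing list \<Rightarrow> move \<Rightarrow> move \<Rightarrow> bool" where
  "occurs_after fs x y \<longleftrightarrow> (\<exists>s t. occurs_at fs x s \<and> occurs_at fs y t \<and> t < s)"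

text \<open>Earlier moves are larger.\<close>

definition endgame_poset :: "nat \<Rightarrow> move gorder" where
  "endgame_poset n =
     \<lparr>carrier = {(i, j). i \<ge> 1 \<and> level i + j < n},
      eq = (=),
      le = (\<lambda>x y. \<forall>fs. complete_firing_sequence n fs \<longrightarrow> \<not> occurs_after fs y x)\<rparr>"

fun endgame_rank :: "move \<Rightarrow> nat" where
  "endgame_rank (i, j) = level i + 2 * j"

fun flip_horizontal :: "move \<Rightarrow> move" where
  "flip_horizontal (i, j) = (2 ^ level i + 2 ^ (level i - 1) - 1 - i, j)"

fun flip_vertical :: "nat \<Rightarrow> move \<Rightarrow> move" where
  "flip_vertical n (i, j) = (i, n - 1 - level i - j)"

definition modular_lattice :: "('a, 'm) gorder_scheme \<Rightarrow> bool" where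
  "modular_lattice L \<longleftrightarrow> lattice L \<and>
     (\<forall>x\<in>carrier L. \<forall>y\<in>carrier L. \<forall>z\<in>carrier L. x \<sqsubseteq>\<^bsub>L\<^esub> z \<longrightarrow>
        x \<squnion>\<^bsub>L\<^esub> (y \<sqinter>\<^bsub>L\<^esub> z) = (x \<squnion>\<^bsub>L\<^esub> y) \<sqinter>\<^bsub>L\<^esub> z)"

definition covered_by :: "('a, 'm) gorder_scheme \<Rightarrow> 'a \<Rightarrow> 'a \<Rightarrow> bool" where
  "covered_by L x y \<longleftrightarrow> x \<in> carrier L \<and> y \<in> carrier L \<and> x \<sqsubset>\<^bsub>L\<^esub> y \<and>
     \<not> (\<exists>z\<in>carrier L. x \<sqsubset>\<^bsub>L\<^esub> z \<and> z \<sqsubset>\<^bsub>L\<^esub> y)"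

text \<open>Minimal elements are not required to have rank 0.\<close>

definition rank_function :: "('a, 'm) gorder_scheme \<Rightarrow> ('a \<Rightarrow> nat) \<Rightarrow> bool" where
  "rank_function L \<rho> \<longleftrightarrow>
     (\<forall>x\<in>carrier L. \<forall>y\<in>carrier L. x \<sqsubset>\<^bsub>L\<^esub> y \<longrightarrow> \<rho> x < \<rho> y) \<and>
     (\<forall>x y. covered_by L x y \<longrightarrow> \<rho> y = \<rho> x + 1)"

definition order_automorphism :: "('a, 'm) gorder_scheme \<Rightarrow> ('a \<Rightarrow> 'a) \<Rightarrow> bool" where
  "order_automorphism L f \<longleftrightarrow> bij_betw f (carrier L) (carrier L) \<and>
     (\<forall>x\<in>carrier L. \<forall>y\<in>carrier L. f x \<sqsubseteq>\<^bsub>L\<^esub> f y \<longleftrightarrow> x \<sqsubseteq>\<^bsub>L\<^esub> y)"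

definition order_anti_automorphism :: "('a, 'm) gorder_scheme \<Rightarrow> ('a \<Rightarrow> 'a) \<Rightarrow> bool" where
  "order_anti_automorphism L f \<longleftrightarrow> bij_betw f (carrier L) (carrier L) \<and>
     (\<forall>x\<in>carrier L. \<forall>y\<in>carrier L. f x \<sqsubseteq>\<^bsub>L\<^esub> f y \<longleftrightarrow> y \<sqsubseteq>\<^bsub>L\<^esub> x)"

end

theory Submission
  imports Defs
begin

text \<open>
  Whether a firing is possible depends only on the number of chips at each node, and the number of
  times each node fires does not depend on the sequence (least action principle). The stable
  position has one chip at each node of the first \<open>n\<close> levels. Write \<open>r\<close> for the number of firings
  that each node still has to perform and truncate \<open>r i\<close> at \<open>n - level i\<close>. Then along each edge the
  truncated value at the parent exceeds that at the child by 0 or 1, and legality of a firing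
  amounts to preserving this. Conversely every truncated \<open>r\<close> with this property is reached and
  left by legal firings. It follows that \<open>(i, j) \<le> (i', j')\<close> in the poset iff
  \<open>j + level i \<le> j' + d\<close>, where \<open>d\<close> is the level of the lowest common ancestor of \<open>i\<close> and \<open>i'\<close>.
  This order is visibly invariant under both flips. The join of incomparable moves lies on the tree
  path between the two nodes and has rank \<open>(j + level i) + (j' + level i') - d\<close>; dually the meet has
  rank \<open>j + j' + d\<close>.
\<close>

section \<open>Ancestors in the binary tree\<close>

lemma level_pos: "1 \<le> level i"
  by (simp add: level_def)

lemma level_eqI: "2 ^ l \<le> i \<Longrightarrow> i < 2 ^ Suc l \<Longrightarrow> level i = Suc l"
  using floor_log_nat_eq_if[of 2 l i] by (simp add: level_def)

lemma level_bounds: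
  assumes "1 \<le> i"
  shows "2 ^ (level i - 1) \<le> i" and "i < 2 ^ level i"
proof -
  have "\<exists>l. 2 ^ l \<le> i \<and> i < 2 ^ (l + 1)"
    using ex_power_ivl1[of 2 i] assms by auto
  then obtain l where "2 ^ l \<le> i" "i < 2 ^ Suc l" by auto
  with level_eqI[OF this] show "2 ^ (level i - 1) \<le> i" "i < 2 ^ level i" by auto
qed

lemma level_1 [simp]: "level 1 = 1" "level (Suc 0) = 1"
  using level_eqI[of 0 1] by auto

lemma level_double:
  assumes "1 \<le> i"
  shows "level (2 * i) = Suc (level i)" and "level (2 * i + 1) = Suc (level i)"
proof -
  obtain l where l: "level i = Suc l" using level_pos[of i] by (cases "level i") auto
  with level_bounds[OF assms] have "2 ^ l \<le> i" "i < 2 ^ Suc l" by auto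
  then have "level (2 * i) = Suc (Suc l)" "level (2 * i + 1) = Suc (Suc l)"
    by (intro level_eqI; simp)+
  then show "level (2 * i) = Suc (level i)" "level (2 * i + 1) = Suc (level i)"
    using l by auto
qed

lemma level_half:
  assumes "2 \<le> k"
  shows "level k = Suc (level (k div 2))"
proof -
  have "1 \<le> k div 2" "k = 2 * (k div 2) \<or> k = 2 * (k div 2) + 1" using assms by auto
  then show ?thesis using level_double[of "k div 2"] by metis
qed

lemma level_eq_1: "1 \<le> i \<Longrightarrow> level i = 1 \<Longrightarrow> i = 1"
  using level_bounds[of i] by auto

text \<open>Going up drops binary digits from the right. At level 0 this gives the value 0, which
  lies outside the tree and is shared by all nodes; for \<open>t\<close> beyond
  \<open>level i\<close>, truncated subtraction returns \<open>i\<close> itself.\<close>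

definition ancestor :: "nat \<Rightarrow> nat \<Rightarrow> nat" where
  "ancestor i t = i div 2 ^ (level i - t)"

lemma level_ancestor:
  assumes "1 \<le> i" "1 \<le> t" "t \<le> level i"
  shows "level (ancestor i t) = t"
proof -
  obtain u where u: "t = Suc u" using assms by (cases t) auto
  obtain e where e: "level i = t + e" using assms le_Suc_ex by blast
  have "2 ^ u \<le> i div 2 ^ e" "i div 2 ^ e < 2 ^ Suc u"
    using level_bounds[OF assms(1)] unfolding e u
    by (simp_all add: less_eq_div_iff_mult_less_eq less_mult_imp_div_less power_add)
  then have "level (i div 2 ^ e) = Suc u" by (rule level_eqI)
  then show ?thesis by (simp add: ancestor_def e u)
qed

lemma ancestor_pos:
  assumes "1 \<le> i" "1 \<le> t" "t \<le> level i"
  shows "1 \<le> ancestor i t"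
proof -
  have "(2::nat) ^ (level i - t) \<le> 2 ^ (level i - 1)" using assms by (intro power_increasing) auto
  also have "\<dots> \<le> i" using level_bounds assms by auto
  finally show ?thesis by (simp add: ancestor_def less_eq_div_iff_mult_less_eq)
qed

lemma ancestor_ancestor:
  assumes "1 \<le> i" "1 \<le> u" "t \<le> u" "u \<le> level i"
  shows "ancestor (ancestor i u) t = ancestor i t"
proof -
  have "ancestor (ancestor i u) t = ancestor i u div 2 ^ (u - t)"
    using level_ancestor[of i u] assms by (simp add: ancestor_def)
  also have "\<dots> = i div (2 ^ (level i - u) * 2 ^ (u - t))"
    by (simp add: ancestor_def div_mult2_eq)
  also have "\<dots> = ancestor i t"
    using assms by (simp add: ancestor_def flip: power_add)
  finally show ?thesis .
qed

lemma ancestor_self [simp]: "ancestor i (level i) = i"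
  by (simp add: ancestor_def)

lemma ancestor_0: "1 \<le> i \<Longrightarrow> ancestor i 0 = 0"
  using level_bounds(2)[of i] by (simp add: ancestor_def)

lemma ancestor_1: "1 \<le> i \<Longrightarrow> ancestor i 1 = 1"
  using level_ancestor[of i 1] ancestor_pos[of i 1] level_pos[of i] level_eq_1 by auto

lemma ancestor_half:
  assumes "2 \<le> k" "t < level k"
  shows "ancestor (k div 2) t = ancestor k t"
proof -
  have "level k - t = Suc (level (k div 2) - t)"
    using level_half[OF assms(1)] assms(2) by auto
  then show ?thesis by (simp add: ancestor_def div_mult2_eq)
qed

section \<open>Depth of the lowest common ancestor\<close>

definition common_depth :: "nat \<Rightarrow> nat \<Rightarrow> nat" where
  "common_depth i k = Max {t. t \<le> level i \<and> t \<le> level k \<and> ancestor i t = ancestor k t}"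

text \<open>Agreement of ancestors passes to smaller levels, so the set under \<open>Max\<close> is
  an initial segment, and it contains 0. Claims about \<open>common_depth\<close> thereby become
  claims about single levels.\<close>

lemma le_common_depth_iff:
  assumes "1 \<le> i" "1 \<le> k"
  shows "t \<le> common_depth i k \<longleftrightarrow> t \<le> level i \<and> t \<le> level k \<and> ancestor i t = ancestor k t"
proof -
  let ?S = "{t. t \<le> level i \<and> t \<le> level k \<and> ancestor i t = ancestor k t}"
  have fin: "finite ?S" by (rule finite_subset[of _ "{..level i}"]) auto
  have ne: "?S \<noteq> {}" using ancestor_0[OF assms(1)] ancestor_0[OF assms(2)] by (auto intro: exI[of _ 0])
  have M: "Max ?S \<in> ?S" using Max_in[OF fin ne] .
  show ?thesis
  proof
    assume t: "t \<le> common_depth i k"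
    show "t \<le> level i \<and> t \<le> level k \<and> ancestor i t = ancestor k t"
    \<comment> \<open>\<open>ancestor_ancestor\<close> asks for a positive intermediate
      level.\<close>
    proof (cases "Max ?S = 0")
      case True
      then show ?thesis using t M by (simp add: common_depth_def)
    next
      case False
      then show ?thesis
        using t M ancestor_ancestor[OF assms(1), of "Max ?S" t]
          ancestor_ancestor[OF assms(2), of "Max ?S" t]
        by (simp add: common_depth_def)
    qed
  next
    assume "t \<le> level i \<and> t \<le> level k \<and> ancestor i t = ancestor k t"
    then show "t \<le> common_depth i k" using fin by (simp add: common_depth_def)
  qed
qed

lemma common_depth_commute: "common_depth i k = common_depth k i"
  unfolding common_depth_def by (rule arg_cong[of _ _ Max]) auto

lemma common_depth_facts:
  assumes "1 \<le> i" "1 \<le> k"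
  shows "common_depth i k \<le> level i" "common_depth i k \<le> level k"
    "ancestor i (common_depth i k) = ancestor k (common_depth i k)" "1 \<le> common_depth i k"
  using le_common_depth_iff[OF assms, of "common_depth i k"] le_common_depth_iff[OF assms, of 1]
    ancestor_1 assms level_pos by auto

lemma common_depth_self: "1 \<le> i \<Longrightarrow> common_depth i i = level i"
  using common_depth_facts(1)[of i i] le_common_depth_iff[of i i "level i"] by auto

text \<open>Agreement at a fixed level is transitive. This ultrametric inequality later yields
  transitivity of the order and minimality of joins.\<close>

lemma common_depth_ultra:
  assumes "1 \<le> i" "1 \<le> k" "1 \<le> m"
  shows "min (common_depth i k) (common_depth k m) \<le> common_depth i m"
proof -
  let ?t = "min (common_depth i k) (common_depth k m)"
  have "?t \<le> common_depth i k" "?t \<le> common_depth k m" by auto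
  then show ?thesis
    unfolding le_common_depth_iff[OF assms(1,2)] le_common_depth_iff[OF assms(2,3)]
      le_common_depth_iff[OF assms(1,3)] by auto
qed

text \<open>The path from the root to \<open>ancestor i t\<close> is the path to \<open>i\<close>
  cut off at level \<open>t\<close>.\<close>

lemma common_depth_ancestor:
  assumes "1 \<le> i" "1 \<le> k" "1 \<le> t" "t \<le> level i"
  shows "common_depth (ancestor i t) k = min t (common_depth i k)"
proof -
  have "u \<le> common_depth (ancestor i t) k \<longleftrightarrow> u \<le> min t (common_depth i k)" for u
    using assms ancestor_pos[of i t] level_ancestor[of i t] ancestor_ancestor[of i t u]
    by (auto simp: le_common_depth_iff)
  then show ?thesis by (intro le_antisym) auto
qed

lemma half_eq_ancestor: "2 \<le> k \<Longrightarrow> k div 2 = ancestor k (level k - 1)"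
  using level_half[of k] by (simp add: ancestor_def)

lemma common_depth_half:
  assumes "1 \<le> i" "2 \<le> k"
  shows "common_depth i (k div 2) = min (level k - 1) (common_depth i k)"
proof -
  have "1 \<le> level k - 1" using level_half[OF assms(2)] level_pos[of "k div 2"] by linarith
  then have "common_depth (ancestor k (level k - 1)) i = min (level k - 1) (common_depth k i)"
    using common_depth_ancestor[of k i "level k - 1"] assms by simp
  then show ?thesis unfolding half_eq_ancestor[OF assms(2)] common_depth_commute[of i] .
qed

section \<open>Left-right reflection of the tree\<close>

definition mirror :: "nat \<Rightarrow> nat" where
  "mirror i = 2 ^ level i + 2 ^ (level i - 1) - 1 - i"

lemma level_mirror:
  assumes "1 \<le> i"
  shows "level (mirror i) = level i"
proof -
  obtain l where l: "level i = Suc l" using level_pos[of i] by (cases "level i") auto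
  with level_bounds[OF assms] have "2 ^ l \<le> i" "i < 2 ^ Suc l" by auto
  then have "2 ^ l \<le> mirror i" "mirror i < 2 ^ Suc l" by (auto simp: mirror_def l)
  then show ?thesis using l level_eqI by simp
qed

lemma mirror_pos:
  assumes "1 \<le> i"
  shows "1 \<le> mirror i"
proof -
  have "(1::nat) \<le> 2 ^ (level i - 1)" by simp
  with level_bounds(2)[OF assms] show ?thesis unfolding mirror_def by linarith
qed

lemma mirror_mirror: "1 \<le> i \<Longrightarrow> mirror (mirror i) = i"
  using level_mirror[of i] level_bounds[of i] by (simp add: mirror_def)

text \<open>In binary, \<open>mirror\<close> complements every digit below the leading one, and this
  commutes with dropping the last digit.\<close>

lemma mirror_half:
  assumes "2 \<le> k"
  shows "mirror k div 2 = mirror (k div 2)"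
proof -
  obtain l where l: "level (k div 2) = Suc l" using level_pos[of "k div 2"] by (cases "level (k div 2)") auto
  then have "level k = Suc (Suc l)" using level_half[OF assms] by simp
  moreover have "k < 2 ^ Suc (Suc l)" using level_bounds[of k] assms calculation by auto
  ultimately show ?thesis using l by (simp add: mirror_def)
qed

lemma ancestor_mirror:
  assumes "1 \<le> i" "1 \<le> t" "t \<le> level i"
  shows "ancestor (mirror i) t = mirror (ancestor i t)"
  using assms
proof (induction "level i - t" arbitrary: i)
  case 0
  then have "t = level i" by simp
  then show ?case using level_mirror[of i] 0 by (metis ancestor_self)
next
  case (Suc e)
  have lev: "t < level i" and "i \<noteq> 1" using Suc.hyps(2) Suc.prems(2) by (linarith, force)
  then have i2: "2 \<le> i" using Suc.prems(1) by linarith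
  have m2: "2 \<le> mirror i"
    using lev Suc.prems(1,2) mirror_pos[of i] level_mirror[of i] by (cases "mirror i = 1") auto
  have "ancestor (mirror i) t = ancestor (mirror i div 2) t"
    using ancestor_half[OF m2, of t] lev level_mirror[OF Suc.prems(1)] by simp
  also have "\<dots> = ancestor (mirror (i div 2)) t" by (simp only: mirror_half[OF i2])
  also have "\<dots> = mirror (ancestor (i div 2) t)"
  proof (rule Suc.hyps(1))
    show "e = level (i div 2) - t" "t \<le> level (i div 2)"
      using Suc.hyps(2) level_half[OF i2] lev by linarith+
  qed (use i2 Suc.prems in auto)
  also have "\<dots> = mirror (ancestor i t)" by (simp only: ancestor_half[OF i2 lev])
  finally show ?case .
qed

lemma common_depth_mirror:
  assumes "1 \<le> i" "1 \<le> k"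
  shows "common_depth (mirror i) (mirror k) = common_depth i k"
proof -
  have "t \<le> common_depth (mirror i) (mirror k) \<longleftrightarrow> t \<le> common_depth i k" for t
  proof (cases "1 \<le> t \<and> t \<le> level i \<and> t \<le> level k")
    case True
    then have "1 \<le> ancestor i t" "1 \<le> ancestor k t" using ancestor_pos assms by auto
    then have "mirror (ancestor i t) = mirror (ancestor k t) \<longleftrightarrow> ancestor i t = ancestor k t"
      using mirror_mirror by metis
    then show ?thesis
      using True assms
      by (simp add: le_common_depth_iff mirror_pos level_mirror ancestor_mirror del: One_nat_def)
  next
    case False
    then show ?thesis
      using assms
      by (cases "t = 0") (auto simp: le_common_depth_iff mirror_pos level_mirror simp del: One_nat_def)
  qed
  then show ?thesis by (intro le_antisym) auto
qed

section \<open>Firing unlabelled chips\<close>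

text \<open>
  Here \<open>r i\<close> counts the firings of node \<open>i\<close>. The root needs no separate formula, being its own
  parent; index 0 is not a node, and the formula would wrongly make it the parent of 1.
\<close>

definition after :: "(nat \<Rightarrow> int) \<Rightarrow> (nat \<Rightarrow> int) \<Rightarrow> nat \<Rightarrow> int" where
  "after U r k =
     (if k = 0 then U 0 else U k + r (parent k) + r (2 * k) + r (2 * k + 1) - 3 * r k)"

definition fired :: "nat list \<Rightarrow> nat \<Rightarrow> int" where
  "fired xs i = int (count_list xs i)"

fun node_legal :: "(nat \<Rightarrow> int) \<Rightarrow> nat list \<Rightarrow> bool" where
  "node_legal U [] \<longleftrightarrow> True"
| "node_legal U (i # xs) \<longleftrightarrow> 1 \<le> i \<and> 3 \<le> U i \<and> node_legal (after U (fired [i])) xs"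

text \<open>Firing changes chip counts linearly in the firing counts. These may be negative, which
  lets firings be undone, as in \<open>before\<close>.\<close>

lemma after_after: "after (after U r) s = after U (\<lambda>k. r k + s k)"
  by (simp add: after_def fun_eq_iff)

lemma after_fired_Nil [simp]: "after U (fired []) = U"
  by (simp add: after_def fired_def fun_eq_iff)

lemma after_fired_append:
  "after U (fired (xs @ ys)) = after (after U (fired xs)) (fired ys)"
  by (simp add: after_def fired_def fun_eq_iff)

lemma after_fired_Cons: "after U (fired (i # xs)) = after (after U (fired [i])) (fired xs)"
  using after_fired_append[of U "[i]" xs] by simp

lemma node_legal_append:
  "node_legal U (xs @ ys) \<longleftrightarrow> node_legal U xs \<and> node_legal (after U (fired xs)) ys"
proof (induction xs arbitrary: U)
  case Nil
  show ?case by simp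
next
  case (Cons i xs)
  show ?case using Cons[of "after U (fired [i])"] after_fired_Cons[of U i xs] by simp
qed

lemma node_legal_mono:
  assumes "node_legal U xs" "\<And>k. U k \<le> V k"
  shows "node_legal V xs"
  using assms
proof (induction xs arbitrary: U V)
  case (Cons i xs)
  have "node_legal (after V (fired [i])) xs"
  proof (rule Cons.IH)
    show "node_legal (after U (fired [i])) xs" using Cons.prems(1) by simp
    show "after U (fired [i]) k \<le> after V (fired [i]) k" for k
      using Cons.prems(2)[of k] by (auto simp: after_def)
  qed
  then show ?case using Cons.prems order_trans[of 3 "U i" "V i"] by auto
qed simp

text \<open>Least action principle: at the first firing in \<open>xs\<close> that would exceed the
  count in \<open>ys\<close>, the firing node would hold no more chips than it does after
  \<open>ys\<close>, hence fewer than 3.\<close>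

lemma count_le_stabilizing:
  assumes "node_legal U xs" "\<And>k. after U (fired ys) k < 3"
  shows "count_list xs k \<le> count_list ys k"
  using assms(1)
proof (induction xs arbitrary: k rule: rev_induct)
  case (snoc i xs)
  have le: "count_list xs k \<le> count_list ys k" for k
    using snoc by (simp add: node_legal_append)
  have "3 \<le> after U (fired xs) i" using snoc.prems by (simp add: node_legal_append)
  \<comment> \<open>With equal counts at \<open>i\<close>, only the neighbours matter; they have
    sent \<open>i\<close> at most as many chips as in \<open>ys\<close>.\<close>
  have "count_list xs i \<noteq> count_list ys i"
  proof
    assume "count_list xs i = count_list ys i"
    then have "after U (fired xs) i \<le> after U (fired ys) i"
      using le[of "parent i"] le[of "2 * i"] le[of "2 * i + 1"]
      by (simp add: after_def fired_def)
    then show False using \<open>3 \<le> after U (fired xs) i\<close> assms(2)[of i] by simp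
  qed
  then show ?case using le[of k] le[of i] by auto
qed simp

lemma count_eq_stabilizing:
  assumes "node_legal U xs" "\<And>k. after U (fired xs) k < 3"
    and "node_legal U ys" "\<And>k. after U (fired ys) k < 3"
  shows "count_list xs = count_list ys"
  using count_le_stabilizing[OF assms(1,4)] count_le_stabilizing[OF assms(3,2)]
  by (intro ext le_antisym)

section \<open>From labelled to unlabelled chips\<close>

definition chip_count :: "nat \<Rightarrow> config \<Rightarrow> nat \<Rightarrow> int" where
  "chip_count n C k = int (card {c \<in> chips n. C c = k})"

lemma finite_chips: "finite (chips n)"
  by (simp add: chips_def)

lemma chip_count_sum: "chip_count n C k = (\<Sum>c\<in>chips n. of_bool (C c = k))"
  by (simp add: chip_count_def finite_chips of_bool_def sum.If_cases Int_def)

text \<open>Only the three fired chips move, so the change in the counts is that of a single firing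
  on the empty position.\<close>

lemma chip_count_fire:
  assumes "legal n C (i, a, b, c)" "1 \<le> i"
  shows "chip_count n (fire (i, a, b, c) C) = after (chip_count n C) (fired [i])"
proof
  fix k
  have abc: "{a, b, c} \<subseteq> chips n" "a \<noteq> b" "b \<noteq> c" "a \<noteq> c" "C a = i" "C b = i" "C c = i"
    using assms by auto
  have split: "chip_count n D k = (\<Sum>d\<in>chips n - {a, b, c}. of_bool (D d = k))
      + of_bool (D a = k) + of_bool (D b = k) + of_bool (D c = k)" for D
    using sum.subset_diff[OF abc(1) finite_chips, of "\<lambda>d. of_bool (D d = k) :: int"] abc(2-4)
    by (simp add: chip_count_sum)
  have "chip_count n (fire (i, a, b, c) C) k = (\<Sum>d\<in>chips n - {a, b, c}. of_bool (C d = k))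
      + of_bool (2 * i = k) + of_bool (parent i = k) + of_bool (2 * i + 1 = k)"
    unfolding split[of "fire (i, a, b, c) C"] using abc(2-4) by (auto intro!: sum.cong)
  moreover have "chip_count n C k = (\<Sum>d\<in>chips n - {a, b, c}. of_bool (C d = k)) + 3 * of_bool (i = k)"
    unfolding split[of C] using abc(5-7) by simp
  moreover have "of_bool (2 * i = k) + of_bool (parent i = k) + of_bool (2 * i + 1 = k) - 3 * of_bool (i = k)
      = after (\<lambda>_. 0) (fired [i]) k"
  proof (cases "k = 0")
    case True
    then show ?thesis using assms(2) by (auto simp: after_def parent_def)
  next
    case False
    \<comment> \<open>The term for \<open>i = 1\<close> and \<open>k = 1\<close> is the chip that
      the root keeps. It appears here as well as in the next equation, which reconciles the
      self-loop with \<open>parent 1 = 1\<close>.\<close>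
    have "of_bool (2 * i = k) + of_bool (2 * i + 1 = k) + of_bool (i = 1 \<and> k = 1)
      = (of_bool (i = parent k) :: int)"
      using assms(2) by (auto simp: parent_def)
    moreover have "of_bool (parent i = k)
      = of_bool (i = 1 \<and> k = 1) + of_bool (i = 2 * k) + (of_bool (i = 2 * k + 1) :: int)"
      using assms(2) False by (auto simp: parent_def)
    moreover have "fired [i] m = of_bool (i = m)" for m by (simp add: fired_def)
    ultimately show ?thesis using False by (simp add: after_def)
  qed
  moreover have "after (chip_count n C) (fired [i]) k
      = chip_count n C k + after (\<lambda>_. 0) (fired [i]) k"
    by (simp add: after_def)
  ultimately show "chip_count n (fire (i, a, b, c) C) k = after (chip_count n C) (fired [i]) k"
    by linarith
qed

lemma chip_count_legal:
  assumes "legal n C (i, a, b, c)"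
  shows "3 \<le> chip_count n C i"
proof -
  have "card {a, b, c} \<le> card {c \<in> chips n. C c = i}"
    using assms finite_chips by (intro card_mono) auto
  then show ?thesis using assms by (simp add: chip_count_def)
qed

lemma ex_legal:
  assumes "3 \<le> chip_count n C i"
  shows "\<exists>a b c. legal n C (i, a, b, c)"
proof -
  have "3 \<le> card {c \<in> chips n. C c = i}" using assms by (simp add: chip_count_def)
  then obtain T where T: "T \<subseteq> {c \<in> chips n. C c = i}" "card T = 3"
    by (meson obtain_subset_with_card_n)
  obtain x y z where xyz: "T = {x, y, z}" "x \<noteq> y" "y \<noteq> z" "x \<noteq> z"
    using T(2) by (auto simp: card_3_iff)
  have "{x, y, z} \<subseteq> chips n" "C x = i" "C y = i" "C z = i" using T(1) xyz(1) by auto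
  moreover have "x < y \<and> y < z \<or> x < z \<and> z < y \<or> y < x \<and> x < z \<or> y < z \<and> z < x
      \<or> z < x \<and> x < y \<or> z < y \<and> y < x"
    using xyz by linarith
  ultimately show ?thesis by (auto 0 3)
qed

lemma stable_iff: "stable n C \<longleftrightarrow> (\<forall>k. chip_count n C k < 3)"
  by (simp add: stable_def chip_count_def)

text \<open>Labels are forgotten one firing at a time. The invariant that chips lie at positive
  nodes provides the condition \<open>1 \<le> i\<close> in \<open>node_legal\<close>.\<close>

lemma completes_imp_node_legal:
  assumes "completes n C fs" "\<And>c. 1 \<le> C c"
  shows "node_legal (chip_count n C) (map fst fs)
    \<and> (\<forall>k. after (chip_count n C) (fired (map fst fs)) k < 3)"
  using assms
proof (induction fs arbitrary: C)
  case Nil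
  then show ?case by (simp add: stable_iff)
next
  case (Cons f fs)
  obtain i a b c where f: "f = (i, a, b, c)" by (cases f) auto
  have leg: "legal n C (i, a, b, c)" and i: "1 \<le> i"
    using Cons.prems(1) Cons.prems(2)[of a] by (auto simp: f)
  have "1 \<le> fire f C d" for d
    using Cons.prems(2)[of d] i by (auto simp: f parent_def)
  with Cons.IH[of "fire f C"] Cons.prems(1)
  have "node_legal (chip_count n (fire f C)) (map fst fs)"
    "\<forall>k. after (chip_count n (fire f C)) (fired (map fst fs)) k < 3"
    by auto
  then show ?case
    unfolding f chip_count_fire[OF leg i]
    using chip_count_legal[OF leg] i after_fired_Cons[of "chip_count n C" i "map fst fs"]
    by simp
qed

text \<open>Labels never obstruct a firing: any three chips at the node can be sorted and fired, and
  the resulting counts do not depend on the choice.\<close>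

lemma node_legal_imp_completes:
  assumes "node_legal (chip_count n C) xs" "\<And>k. after (chip_count n C) (fired xs) k < 3"
  shows "\<exists>fs. completes n C fs \<and> map fst fs = xs"
  using assms
proof (induction xs arbitrary: C)
  case Nil
  then show ?case
    by (intro exI[of _ "[]"]) (simp add: stable_iff)
next
  case (Cons i xs)
  have i: "1 \<le> i" using Cons.prems(1) by simp
  obtain a b c where leg: "legal n C (i, a, b, c)"
    using ex_legal[of n C i] Cons.prems(1) by auto
  note step = chip_count_fire[OF leg i]
  have "\<exists>fs. completes n (fire (i, a, b, c) C) fs \<and> map fst fs = xs"
  proof (rule Cons.IH)
    show "node_legal (chip_count n (fire (i, a, b, c) C)) xs"
      using Cons.prems(1) unfolding step by simp
    show "after (chip_count n (fire (i, a, b, c) C)) (fired xs) k < 3" for k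
      unfolding step using Cons.prems(2)[of k] after_fired_Cons[of "chip_count n C" i xs] by simp
  qed
  then obtain fs where "completes n (fire (i, a, b, c) C) fs" "map fst fs = xs" by auto
  then show ?case using leg by (intro exI[of _ "(i, a, b, c) # fs"]) simp
qed

definition at_root :: "int \<Rightarrow> nat \<Rightarrow> int" where
  "at_root m k = (if k = 1 then m else 0)"

lemma chip_count_start: "chip_count n (\<lambda>_. 1) = at_root (2 ^ n - 1)"
proof (rule ext)
  fix k :: nat
  have "{c \<in> chips n. 1 = k} = (if k = 1 then {1..2 ^ n - 1} else {})"
    by (auto simp: chips_def)
  then show "chip_count n (\<lambda>_. 1) k = at_root (2 ^ n - 1) k"
    by (simp add: chip_count_def at_root_def of_nat_diff)
qed

definition node_complete :: "nat \<Rightarrow> nat list \<Rightarrow> bool" where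
  "node_complete n xs \<longleftrightarrow>
     node_legal (at_root (2 ^ n - 1)) xs \<and> (\<forall>k. after (at_root (2 ^ n - 1)) (fired xs) k < 3)"

lemma complete_imp_node_complete:
  "complete_firing_sequence n fs \<Longrightarrow> node_complete n (map fst fs)"
  using completes_imp_node_legal[of n "\<lambda>_. 1" fs]
  by (simp add: complete_firing_sequence_def node_complete_def chip_count_start del: One_nat_def)

lemma node_complete_imp_complete:
  "node_complete n xs \<Longrightarrow> \<exists>fs. complete_firing_sequence n fs \<and> map fst fs = xs"
  using node_legal_imp_completes[of n "\<lambda>_. 1" xs]
  by (simp add: complete_firing_sequence_def node_complete_def chip_count_start del: One_nat_def)

lemma count_list_conv_card: "count_list xs i = card {u. u < length xs \<and> xs ! u = i}"
  by (auto simp: count_list_eq_length_filter length_filter_conv_card intro: arg_cong[of _ _ card])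

lemma occurs_at_iff:
  "occurs_at fs (i, j) t \<longleftrightarrow> t < length fs \<and> map fst fs ! t = i
     \<and> count_list (drop (Suc t) (map fst fs)) i = j"
proof -
  have "bij_betw (\<lambda>u. u - Suc t) {u. t < u \<and> u < length fs \<and> fst (fs ! u) = i}
    {u. u < length (drop (Suc t) (map fst fs)) \<and> drop (Suc t) (map fst fs) ! u = i}"
    by (rule bij_betwI[where g = "\<lambda>u. u + Suc t"]) (auto simp: add.commute)
  then show ?thesis by (auto simp: count_list_conv_card dest: bij_betw_same_card)
qed

section \<open>The endgame\<close>

definition ones :: "nat \<Rightarrow> nat \<Rightarrow> int" where
  "ones n k = of_bool (1 \<le> k \<and> level k \<le> n)"

text \<open>The position in which each node \<open>k\<close> still has to fire \<open>r k\<close> times.\<close>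

definition before :: "nat \<Rightarrow> (nat \<Rightarrow> nat) \<Rightarrow> nat \<Rightarrow> int" where
  "before n r = after (ones n) (\<lambda>k. - int (r k))"

definition tight :: "(nat \<Rightarrow> nat) \<Rightarrow> bool" where
  "tight r \<longleftrightarrow> (\<forall>k\<ge>2. r k \<le> r (k div 2) \<and> r (k div 2) \<le> r k + 1)"

text \<open>These are the possible profiles of remaining firings once no node \<open>k\<close> has
  more than \<open>n - level k\<close> left. The clause \<open>r 0 = 0\<close> disposes of index 0,
  which is not a node.\<close>

definition endgame_state :: "nat \<Rightarrow> (nat \<Rightarrow> nat) \<Rightarrow> bool" where
  "endgame_state n r \<longleftrightarrow> r 0 = 0 \<and> (\<forall>k. n \<le> level k \<longrightarrow> r k = 0) \<and> tight r"

lemma before_fired: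
  assumes "\<And>k. count_list xs k \<le> r k"
  shows "after (before n r) (fired xs) = before n (\<lambda>k. r k - count_list xs k)"
proof -
  have "(\<lambda>k. - int (r k) + fired xs k) = (\<lambda>k. - int (r k - count_list xs k))"
    using assms by (auto simp: fired_def of_nat_diff)
  then show ?thesis by (simp add: before_def after_after)
qed

text \<open>Induction on the number of firings still to be made. Among the pending moves
  \<open>(i, r i - 1)\<close>, one of largest rank is fired; this choice makes the firing legal and
  keeps the profile tight.\<close>

lemma endgame_path:
  assumes "endgame_state n r" "endgame_state n s" "\<And>k. s k \<le> r k"
  shows "\<exists>xs. node_legal (before n r) xs \<and> (\<forall>k. count_list xs k = r k - s k)"
  using assms(1,3)
proof (induction "\<Sum>k<2 ^ n. r k - s k" arbitrary: r rule: less_induct)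
  case less
  show ?case
  proof (cases "r = s")
    case True
    then show ?thesis by (intro exI[of _ "[]"]) simp
  next
    case False
    define S where "S = {k. s k < r k}"
    \<comment> \<open>Pending nodes have index below \<open>2 ^ n\<close>, so the sum used as
      induction measure sees all of them.\<close>
    have lev: "1 \<le> k \<and> level k < n \<and> k < 2 ^ n" if "k \<in> S" for k
    proof -
      have "1 \<le> k" "level k < n"
        using that less.prems(1) by (auto simp: S_def endgame_state_def Suc_le_eq intro!: gr0I leI)
      moreover from this have "k < 2 ^ level k" "(2::nat) ^ level k \<le> 2 ^ n"
        using level_bounds(2) by (auto intro: power_increasing)
      ultimately show ?thesis by linarith
    qed
    have "finite S" by (rule finite_subset[of _ "{..<2 ^ n}"]) (use lev in auto)
    moreover have "S \<noteq> {}" using False less.prems(2) by (auto simp: S_def fun_eq_iff not_less intro: le_antisym)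
    \<comment> \<open>Up to the constant 2, this is the largest rank of a pending move
      \<open>(k, r k - 1)\<close>.\<close>
    moreover define M where "M = Max ((\<lambda>k. level k + 2 * r k) ` S)"
    ultimately have "M \<in> (\<lambda>k. level k + 2 * r k) ` S"
      and ge: "\<And>k. k \<in> S \<Longrightarrow> level k + 2 * r k \<le> M"
      by auto
    then obtain i where i: "i \<in> S"
      and top: "\<And>k. k \<in> S \<Longrightarrow> level k + 2 * r k \<le> level i + 2 * r i"
      by auto
    have i1: "1 \<le> i" "level i < n" "i < 2 ^ n" using lev[OF i] by auto
    have si: "s i < r i" using i by (simp add: S_def)
    have tr: "r k \<le> r (k div 2)" "r (k div 2) \<le> r k + 1" if "2 \<le> k" for k
      using less.prems(1) that by (auto simp: endgame_state_def tight_def)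
    have ts: "s k \<le> s (k div 2)" "s (k div 2) \<le> s k + 1" if "2 \<le> k" for k
      using assms(2) that by (auto simp: endgame_state_def tight_def)
    \<comment> \<open>A child with the same value of \<open>r\<close> would be pending too, with
      rank larger by 1 on account of its level.\<close>
    have child: "r k < r i" if "k div 2 = i" "2 \<le> k" for k
    proof (rule ccontr)
      assume "\<not> r k < r i"
      then have "r k = r i" using tr[OF that(2)] that by simp
      moreover have "s k \<le> s i" using ts[OF that(2)] that by simp
      ultimately have "k \<in> S" using si by (simp add: S_def)
      then show False using top[of k] level_half[OF that(2)] that \<open>r k = r i\<close> by simp
    qed
    \<comment> \<open>A parent with value \<open>r i + 1\<close> would be pending, with rank larger
      by \<open>2 - 1\<close>.\<close>
    have par: "r (parent i) \<le> r i"
    proof (rule ccontr)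
      assume neg: "\<not> r (parent i) \<le> r i"
      then have i2: "2 \<le> i" "parent i = i div 2" using i1 by (auto simp: parent_def split: if_splits)
      then have eq: "r (i div 2) = r i + 1" using neg tr[OF i2(1)] by simp
      then have "i div 2 \<in> S" using ts[OF i2(1)] si by (simp add: S_def)
      then show False using top[of "i div 2"] level_half[OF i2(1)] eq by simp
    qed
    define r' where "r' = (\<lambda>k. r k - count_list [i] k)"
    have r': "r' k = (if k = i then r i - 1 else r k)" for k by (simp add: r'_def)
    have "endgame_state n r'"
      unfolding endgame_state_def tight_def
    proof (intro conjI allI impI)
      fix k :: nat assume k: "2 \<le> k"
      then show "r' k \<le> r' (k div 2)" using tr(1)[OF k] child[of k] by (auto simp: r')
      show "r' (k div 2) \<le> r' k + 1"
      proof (cases "k = i")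
        case True
        then have "r (k div 2) \<le> r i" using par k by (simp add: parent_def)
        then show ?thesis using True k si by (simp add: r')
      next
        case False
        then show ?thesis using tr(2)[OF k] by (auto simp: r' intro: le_trans[OF diff_le_self])
      qed
    qed (use less.prems(1) in \<open>auto simp: endgame_state_def r'\<close>)
    moreover have "s k \<le> r' k" for k using less.prems(2)[of k] si by (auto simp: r')
    moreover have "(\<Sum>k<2 ^ n. r' k - s k) < (\<Sum>k<2 ^ n. r k - s k)"
      by (rule sum_strict_mono_ex1) (use i1 si in \<open>auto simp: r' intro!: bexI[of _ i]\<close>)
    ultimately obtain xs where xs: "node_legal (before n r') xs" "\<And>k. count_list xs k = r' k - s k"
      using less.hyps[of r'] by auto
    have "after (before n r) (fired [i]) = before n r'"
      unfolding r'_def by (rule before_fired) (use si in auto)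
    \<comment> \<open>The node holds at least \<open>1 + 3 * r i - r i - 2 * (r i - 1)\<close>
      chips, which is 3.\<close>
    moreover have "3 \<le> before n r i"
      using child[of "2 * i"] child[of "2 * i + 1"] par i1
      by (simp add: before_def after_def ones_def)
    ultimately have "node_legal (before n r) (i # xs)" using xs(1) i1 by simp
    moreover have "count_list (i # xs) k = r k - s k" for k using xs(2)[of k] si by (auto simp: r')
    ultimately show ?thesis by blast
  qed
qed

text \<open>For a node \<open>k\<close>, this is the number of moves \<open>(k, j)\<close> in the
  poset.\<close>

definition top_state :: "nat \<Rightarrow> nat \<Rightarrow> nat" where
  "top_state n k = (if k = 0 then 0 else n - level k)"

lemma endgame_state_top: "endgame_state n (top_state n)"
  unfolding endgame_state_def tight_def
proof (intro conjI allI impI)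
  fix k :: nat assume k: "2 \<le> k"
  then have "k div 2 \<noteq> 0" by simp
  then show "top_state n k \<le> top_state n (k div 2)" "top_state n (k div 2) \<le> top_state n k + 1"
    using level_half[OF k] k by (simp_all add: top_state_def)
qed (simp_all add: top_state_def)

lemma endgame_state_zero: "endgame_state n (\<lambda>_. 0)"
  by (simp add: endgame_state_def tight_def)

text \<open>The endgame on \<open>Suc n\<close> levels starts from two superposed stable positions
  on \<open>n\<close> levels and one extra chip at the root. This drives the recursion over
  \<open>n\<close>.\<close>

lemma before_top_state:
  "before (Suc n) (top_state (Suc n)) k = 2 * ones n k + at_root 1 k"
proof -
  consider "k = 0" | "k = 1" | "2 \<le> k" by linarith
  then show ?thesis
  proof cases
    case 1
    then show ?thesis by (simp add: before_def after_def ones_def at_root_def)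
  next
    case 2
    then show ?thesis using level_double[of 1]
      by (cases n) (auto simp: before_def after_def ones_def at_root_def top_state_def parent_def of_nat_diff)
  next
    case 3
    then have "parent k = k div 2" "level (2 * k) = Suc (level k)" "level (2 * k + 1) = Suc (level k)"
      "level k = Suc (level (k div 2))" "k div 2 \<noteq> 0"
      using level_double[of k] level_half[of k] by (auto simp: parent_def)
    then show ?thesis using 3
      by (auto simp: before_def after_def ones_def at_root_def top_state_def of_nat_diff)
  qed
qed

text \<open>
  Of the \<open>2 ^ Suc n - 1\<close> chips, stabilise \<open>2 ^ n - 1\<close> and then another \<open>2 ^ n - 1\<close>, leaving one
  chip at rest at the root: this reaches the position from which the endgame is played.
\<close>

lemma stabilization_through:
  assumes "endgame_state n s" "\<And>k. s k \<le> top_state n k"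
  shows "\<exists>xs ys. node_legal (at_root (2 ^ n - 1)) (xs @ ys)
    \<and> after (at_root (2 ^ n - 1)) (fired (xs @ ys)) = ones n
    \<and> (\<forall>k. top_state n k - s k \<le> count_list xs k) \<and> count_list ys = s"
  using assms
proof (induction n arbitrary: s)
  case 0
  then have "s = (\<lambda>_. 0)" by (simp add: endgame_state_def fun_eq_iff)
  moreover have "at_root 0 = ones 0" by (auto simp: at_root_def ones_def level_def fun_eq_iff)
  ultimately show ?case
    by (intro exI[of _ "[]"]) (auto simp: top_state_def)
next
  case (Suc n)
  let ?U = "at_root (2 ^ n - 1)" and ?V = "at_root (2 ^ Suc n - 1)" and ?T = "top_state (Suc n)"
  \<comment> \<open>The zero profile is an endgame state, so the induction hypothesis supplies a
    sequence stabilising \<open>2 ^ n - 1\<close> chips.\<close>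
  obtain xs ys where xy: "node_legal ?U (xs @ ys)" "after ?U (fired (xs @ ys)) = ones n"
    using Suc.IH[of "\<lambda>_. 0"] endgame_state_zero by auto
  define zs where "zs = xs @ ys"
  note z = xy[folded zs_def]
  have V: "?V k = 2 * ?U k + at_root 1 k" for k by (simp add: at_root_def)
  have U0: "0 \<le> ?U k" "0 \<le> at_root 1 k" for k by (auto simp: at_root_def)
  have shift: "after (\<lambda>k. A k + B k) r k = after A r k + B k" for A B r k
    by (simp add: after_def)
  have V1: "after ?V (fired zs) = (\<lambda>k. ones n k + ?U k + at_root 1 k)"
  proof
    fix k
    have "?V = (\<lambda>k. ?U k + (?U k + at_root 1 k))" using V by (auto simp: fun_eq_iff)
    then show "after ?V (fired zs) k = ones n k + ?U k + at_root 1 k"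
      using shift[of ?U "\<lambda>k. ?U k + at_root 1 k" "fired zs" k] z(2) by simp
  qed
  have V2: "after ?V (fired (zs @ zs)) = before (Suc n) ?T"
  proof
    fix k
    have "after ?V (fired zs) = (\<lambda>k. ?U k + (ones n k + at_root 1 k))"
      unfolding V1 by (auto simp: fun_eq_iff)
    then show "after ?V (fired (zs @ zs)) k = before (Suc n) ?T k"
      using shift[of ?U "\<lambda>k. ones n k + at_root 1 k" "fired zs" k] z(2)
      by (simp add: after_fired_append before_top_state)
  qed
  have leg: "node_legal ?V (zs @ zs)"
    unfolding node_legal_append V1
  proof
    have ones_nonneg: "0 \<le> ones n k" for k by (simp add: ones_def)
    have "?U k \<le> ?V k" for k using V[of k] U0[of k] by linarith
    then show "node_legal ?V zs" by (rule node_legal_mono[OF z(1)])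
    have "?U k \<le> ones n k + ?U k + at_root 1 k" for k using U0[of k] ones_nonneg[of k] by linarith
    then show "node_legal (\<lambda>k. ones n k + ?U k + at_root 1 k) zs"
      by (rule node_legal_mono[OF z(1)])
  qed
  \<comment> \<open>The endgame is split at the prescribed profile \<open>s\<close>:
    \<open>p\<close> leads from the top profile to \<open>s\<close>, and \<open>q\<close> from
    \<open>s\<close> to rest.\<close>
  obtain p where p: "node_legal (before (Suc n) ?T) p" "\<And>k. count_list p k = ?T k - s k"
    using endgame_path[OF endgame_state_top Suc.prems] by auto
  obtain q where q: "node_legal (before (Suc n) s) q" "\<And>k. count_list q k = s k"
    using endgame_path[OF Suc.prems(1) endgame_state_zero] by auto
  have P: "after (before (Suc n) ?T) (fired p) = before (Suc n) s"
    using before_fired[of p ?T "Suc n"] p(2) Suc.prems(2) by (simp add: fun_eq_iff)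
  have Q: "after (before (Suc n) s) (fired q) = ones (Suc n)"
    using before_fired[of q s "Suc n"] q(2)
    by (simp add: before_def) (simp add: after_def fun_eq_iff)
  have 1: "node_legal ?V ((zs @ zs @ p) @ q)"
    using leg p(1) q(1) V2 P by (simp add: node_legal_append after_fired_append)
  have 2: "after ?V (fired ((zs @ zs @ p) @ q)) = ones (Suc n)"
    using V2 P Q by (simp add: after_fired_append)
  show ?case
    by (rule exI[of _ "zs @ zs @ p"], rule exI[of _ q])
      (use 1 2 p(2) q(2) in \<open>simp add: fun_eq_iff\<close>)
qed

text \<open>By the least action principle every complete sequence has the same firing counts as the
  one constructed above.\<close>

lemma node_complete_final:
  assumes "node_complete n xs"
  shows "after (at_root (2 ^ n - 1)) (fired xs) = ones n" "top_state n k \<le> count_list xs k"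
proof -
  obtain ps qs where *: "node_legal (at_root (2 ^ n - 1)) (ps @ qs)"
    "after (at_root (2 ^ n - 1)) (fired (ps @ qs)) = ones n" "\<And>k. top_state n k \<le> count_list ps k"
    using stabilization_through[OF endgame_state_zero, of n] by auto
  have eq: "count_list xs = count_list (ps @ qs)"
    by (rule count_eq_stabilizing[of "at_root (2 ^ n - 1)"])
      (use assms * in \<open>auto simp: node_complete_def ones_def\<close>)
  then have "fired xs = fired (ps @ qs)" by (simp add: fired_def fun_eq_iff)
  then show "after (at_root (2 ^ n - 1)) (fired xs) = ones n" using * by simp
  show "top_state n k \<le> count_list xs k" using *(3)[of k] eq by simp
qed

section \<open>Tightness throughout a complete sequence\<close>

definition truncated :: "nat \<Rightarrow> (nat \<Rightarrow> nat) \<Rightarrow> nat \<Rightarrow> nat" where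
  "truncated n r k = min (r k) (n - level k)"

text \<open>Having 3 chips at the firing node, combined with tightness before an endgame firing,
  leaves no slack: the parent has as many firings left as the node, each child one fewer. Hence
  tightness survives the firing.\<close>

lemma tight_suffix:
  assumes "node_legal (before n (count_list (ps @ qs))) (ps @ qs)"
    and "tight (truncated n (count_list (ps @ qs)))"
  shows "tight (truncated n (count_list qs))"
  using assms
proof (induction ps)
  case (Cons i ps)
  define r where "r = count_list (i # ps @ qs)"
  define r' where "r' = count_list (ps @ qs)"
  let ?g = "truncated n r" and ?g' = "truncated n r'"
  have r': "r k = (if k = i then r' i + 1 else r' k)" for k by (simp add: r_def r'_def)
  have i: "1 \<le> i" "3 \<le> before n r i" "node_legal (after (before n r) (fired [i])) (ps @ qs)"
    using Cons.prems(1) unfolding append_Cons r_def[symmetric] by auto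
  have tg: "?g k \<le> ?g (k div 2)" "?g (k div 2) \<le> ?g k + 1" if "2 \<le> k" for k
    using Cons.prems(2) that unfolding append_Cons r_def[symmetric] tight_def by auto
  have "after (before n r) (fired [i]) = before n r'"
  proof -
    have "(\<lambda>k. r k - count_list [i] k) = r'" using r' by auto
    then show ?thesis using before_fired[of "[i]" r n] r' by simp
  qed
  moreover have "tight ?g'"
  \<comment> \<open>Otherwise the firing precedes the endgame moves of \<open>i\<close>, and the
    truncated profile does not change.\<close>
  proof (cases "r' i < n - level i")
    case False
    then have "?g' = ?g" using r' by (auto simp: truncated_def fun_eq_iff)
    then show ?thesis using Cons.prems(2) unfolding append_Cons r_def[symmetric] by simp
  next
    case True
    have gi: "?g i = r' i + 1" "?g' i = r' i" using True r' by (auto simp: truncated_def)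
    have lower: "r' i \<le> r' k" if "k div 2 = i" for k
    proof -
      have "2 \<le> k" "k \<noteq> i" using that i(1) by auto
      then have "r k = r' k" "?g i \<le> ?g k + 1" using r'[of k] tg(2)[of k] that by auto
      then show ?thesis using gi(1) by (simp add: truncated_def)
    qed
    have ch: "(2 * i) div 2 = i" "(2 * i + 1) div 2 = i" by auto
    \<comment> \<open>This is \<open>3 \<le> before n r i\<close> rewritten with
      \<open>r i = r' i + 1\<close> and one chip of \<open>ones\<close> at \<open>i\<close>.\<close>
    have bound: "r (parent i) + r' (2 * i) + r' (2 * i + 1) \<le> 3 * r' i + 1"
    proof -
      have "ones n i = 1" using i(1) True by (simp add: ones_def)
      then show ?thesis using i(1,2) r'[of i] r'[of "2 * i"] r'[of "2 * i + 1"]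
        by (simp add: before_def after_def)
    qed
    have up: "r' i + 1 \<le> r (parent i)"
      using tg(1)[of i] gi(1) i(1) r'[of i] by (auto simp: parent_def truncated_def)
    \<comment> \<open>The three lower bounds add up to \<open>3 * r' i + 1\<close>, so each holds
      with equality.\<close>
    have "r (parent i) = r' i + 1" "r' (2 * i) = r' i" "r' (2 * i + 1) = r' i"
      using bound up lower[OF ch(1)] lower[OF ch(2)] by auto
    note eqs = this
    have g': "?g' k = (if k = i then r' i else ?g k)" for k using gi r' by (auto simp: truncated_def)
    show ?thesis
      unfolding tight_def
    proof (intro allI impI conjI)
      fix k :: nat assume k: "2 \<le> k"
      show "?g' k \<le> ?g' (k div 2)"
      proof (cases "k div 2 = i")
        case True
        then have "k = 2 * i \<or> k = 2 * i + 1" "k \<noteq> i" using k by auto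
        then have "r' k = r' i" using eqs by auto
        then have "?g' k \<le> r' i" by (simp add: truncated_def)
        then show ?thesis using True gi by simp
      next
        case False
        then show ?thesis using tg(1)[OF k] gi(1) by (auto simp: g')
      qed
      show "?g' (k div 2) \<le> ?g' k + 1"
      proof (cases "k = i")
        case True
        then have "parent i = i div 2" "i div 2 \<noteq> i" using k by (auto simp: parent_def)
        then have "?g (i div 2) \<le> r' i + 1" using eqs(1) by (simp add: truncated_def)
        then show ?thesis using True \<open>i div 2 \<noteq> i\<close> gi by (simp add: g')
      next
        case False
        then show ?thesis using tg(2)[OF k] gi(1) by (auto simp: g')
      qed
    qed
  qed
  ultimately show ?case using Cons.IH i(3) unfolding r'_def by metis
qed simp

text \<open>Every node \<open>k\<close> fires at least \<open>n - level k\<close> times, so at the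
  start the truncated profile is \<open>top_state n\<close>, which is tight;
  \<open>tight_suffix\<close> carries this forward.\<close>

lemma tight_complete:
  assumes "node_complete n (ps @ qs)"
  shows "tight (truncated n (count_list qs))"
proof (rule tight_suffix)
  let ?xs = "ps @ qs"
  have "before n (count_list ?xs) = after (after (at_root (2 ^ n - 1)) (fired ?xs)) (\<lambda>k. - fired ?xs k)"
    unfolding node_complete_final(1)[OF assms] by (simp add: before_def fired_def)
  also have "\<dots> = at_root (2 ^ n - 1)" by (simp add: after_after) (simp add: after_def fun_eq_iff)
  finally show "node_legal (before n (count_list ?xs)) ?xs" using assms by (simp add: node_complete_def)
  have "truncated n (count_list ?xs) k = top_state n k" if "1 \<le> k" for k
    using node_complete_final(2)[OF assms, of k] that by (simp add: truncated_def top_state_def)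
  moreover have "tight (top_state n)" using endgame_state_top[of n] by (simp add: endgame_state_def)
  ultimately show "tight (truncated n (count_list ?xs))" by (simp add: tight_def)
qed

text \<open>The edge inequalities are added up along the path from \<open>i\<close> to its
  ancestor.\<close>

lemma tight_ancestor:
  assumes "tight g" "1 \<le> i" "1 \<le> t" "t \<le> level i"
  shows "g i \<le> g (ancestor i t)" "g (ancestor i t) + t \<le> g i + level i"
proof -
  have "g i \<le> g (ancestor i t) \<and> g (ancestor i t) + t \<le> g i + level i"
    using assms(2-)
  proof (induction "level i - t" arbitrary: i)
    case 0
    then have "t = level i" by simp
    then show ?case by simp
  next
    case (Suc e)
    have lev: "t < level i" and "i \<noteq> 1" using Suc.hyps(2) Suc.prems(2) by (linarith, force)
    then have i2: "2 \<le> i" using Suc.prems(1) by linarith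
    have "g (i div 2) \<le> g (ancestor (i div 2) t)
        \<and> g (ancestor (i div 2) t) + t \<le> g (i div 2) + level (i div 2)"
    proof (rule Suc.hyps(1))
      show "e = level (i div 2) - t" "t \<le> level (i div 2)"
        using Suc.hyps(2) level_half[OF i2] lev by linarith+
    qed (use i2 Suc.prems in auto)
    moreover have "g i \<le> g (i div 2)" "g (i div 2) \<le> g i + 1" using assms(1) i2 by (auto simp: tight_def)
    ultimately show ?case unfolding ancestor_half[OF i2 lev] using level_half[OF i2] by linarith
  qed
  then show "g i \<le> g (ancestor i t)" "g (ancestor i t) + t \<le> g i + level i" by auto
qed

section \<open>The order on moves\<close>

fun move_le :: "move \<Rightarrow> move \<Rightarrow> bool" where
  "move_le (i, j) (i', j') \<longleftrightarrow> j + level i \<le> j' + common_depth i i'"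

lemma count_list_drop_mono:
  assumes "t \<le> u"
  shows "count_list (drop u xs) k \<le> count_list (drop t xs) k"
proof -
  have "drop t xs = take (u - t) (drop t xs) @ drop u xs"
    using assms append_take_drop_id[of "u - t" "drop t xs"] by (simp add: add.commute)
  then show ?thesis by (metis count_list_append le_add2)
qed

lemma count_list_drop_nth:
  "u < length xs \<Longrightarrow> count_list (drop u xs) (xs ! u) = Suc (count_list (drop (Suc u) xs) (xs ! u))"
  by (simp flip: Cons_nth_drop_Suc)

lemma ex_count_list_drop:
  "m < count_list xs i \<Longrightarrow> \<exists>t<length xs. xs ! t = i \<and> count_list (drop (Suc t) xs) i = m"
proof (induction xs)
  case (Cons a xs)
  show ?case
  proof (cases "m < count_list xs i")
    case True
    then obtain t where "t < length xs" "xs ! t = i" "count_list (drop (Suc t) xs) i = m"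
      using Cons.IH by auto
    then show ?thesis by (intro exI[of _ "Suc t"]) simp
  next
    case False
    then have "a = i" "count_list xs i = m" using Cons.prems by (auto split: if_splits)
    then show ?thesis by (intro exI[of _ 0]) simp
  qed
qed simp

text \<open>If \<open>(i, j)\<close> came first, then right after it \<open>i\<close> would have
  \<open>j\<close> firings left and \<open>i'\<close> at least \<open>j' + 1\<close>. Tightness from
  \<open>i\<close> up to the common ancestor and down to \<open>i'\<close> gives
  \<open>j' + 1 \<le> j + level i - common_depth i i'\<close>, contradicting
  \<open>move_le\<close>.\<close>

lemma not_occurs_after_if_move_le:
  assumes "move_le (i, j) (i', j')" "1 \<le> i" "1 \<le> i'" "level i' + j' < n"
    and "complete_firing_sequence n fs"
  shows "\<not> occurs_after fs (i', j') (i, j)"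
proof
  assume "occurs_after fs (i', j') (i, j)"
  then obtain u t where ut: "occurs_at fs (i', j') u" "occurs_at fs (i, j) t" "t < u"
    unfolding occurs_after_def by blast
  define xs where "xs = map fst fs"
  have u: "u < length xs" "xs ! u = i'" "count_list (drop (Suc u) xs) i' = j'"
    and t: "count_list (drop (Suc t) xs) i = j"
    using ut(1,2) unfolding occurs_at_iff by (auto simp: xs_def)
  define g where "g = truncated n (count_list (drop (Suc t) xs))"
  have "node_complete n (take (Suc t) xs @ drop (Suc t) xs)"
    using complete_imp_node_complete[OF assms(5)] by (simp add: xs_def)
  then have g: "tight g" unfolding g_def by (rule tight_complete)
  have "j' + 1 \<le> count_list (drop (Suc t) xs) i'"
    using count_list_drop_nth[OF u(1)] u count_list_drop_mono[of "Suc t" u xs i'] ut(3) by simp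
  \<comment> \<open>Since \<open>level i' + j' < n\<close>, truncation does not cut below
    \<open>j' + 1\<close>.\<close>
  then have "j' + 1 \<le> g i'" using assms(4) by (simp add: g_def truncated_def)
  moreover have "g i \<le> j" using t by (simp add: g_def truncated_def)
  moreover note common_depth_facts[OF assms(2,3)]
  ultimately show False
    using tight_ancestor(1)[OF g assms(3), of "common_depth i i'"]
      tight_ancestor(2)[OF g assms(2), of "common_depth i i'"] assms(1) by simp
qed

text \<open>The profile \<open>s\<close> is the largest endgame state with value \<open>j\<close> at
  \<open>i\<close>. In a sequence passing through \<open>s\<close>, the move \<open>(i, j)\<close>
  is already made, while \<open>(i', j')\<close> is pending because
  \<open>j' < s i'\<close>.\<close>

lemma occurs_after_if_not_move_le:
  assumes "\<not> move_le (i, j) (i', j')" "1 \<le> i" "1 \<le> i'" "level i + j < n" "level i' + j' < n"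
  shows "\<exists>fs. complete_firing_sequence n fs \<and> occurs_after fs (i', j') (i, j)"
proof -
  define s where "s k = (if k = 0 then 0 else min (n - level k) (j + level i - common_depth i k))" for k
  have "endgame_state n s"
    unfolding endgame_state_def tight_def
  proof (intro conjI allI impI)
    fix k :: nat assume k: "2 \<le> k"
    have "common_depth i (k div 2) = min (level k - 1) (common_depth i k)"
      using common_depth_half[OF assms(2) k] .
    moreover have "common_depth i k \<le> level i" "common_depth i k \<le> level k"
      using common_depth_facts[of i k] assms(2) k by auto
    moreover have "s k = min (n - level k) (j + level i - common_depth i k)"
      "s (k div 2) = min (n - level (k div 2)) (j + level i - common_depth i (k div 2))"
      using k by (auto simp: s_def)
    ultimately show "s k \<le> s (k div 2)" "s (k div 2) \<le> s k + 1"
      using level_half[OF k] by linarith+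
  qed (auto simp: s_def)
  moreover have "s k \<le> top_state n k" for k by (simp add: s_def top_state_def)
  ultimately obtain ps qs where *: "node_legal (at_root (2 ^ n - 1)) (ps @ qs)"
    "after (at_root (2 ^ n - 1)) (fired (ps @ qs)) = ones n"
    "\<And>k. top_state n k - s k \<le> count_list ps k" "count_list qs = s"
    using stabilization_through[of n s] by blast
  have "node_complete n (ps @ qs)" using *(1,2) by (simp add: node_complete_def ones_def)
  then obtain fs where fs: "complete_firing_sequence n fs" "map fst fs = ps @ qs"
    using node_complete_imp_complete by blast
  have len: "length fs = length (ps @ qs)" using fs(2) by (metis length_map)
  have si: "s i = j" using assms(2,4) common_depth_self by (simp add: s_def)
  have si': "j' < s i'" using assms(1,3,5) by (auto simp: s_def)
  \<comment> \<open>Before the split \<open>i\<close> fires at least \<open>n - level i - j\<close>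
    times, which is positive, so the move \<open>(i, j)\<close> exists.\<close>
  have "s i < count_list (ps @ qs) i"
    using *(3)[of i] *(4) si assms(2,4) by (simp add: top_state_def)
  then obtain t where t: "t < length (ps @ qs)" "(ps @ qs) ! t = i"
    "count_list (drop (Suc t) (ps @ qs)) i = s i"
    using ex_count_list_drop[of _ "ps @ qs"] by metis
  have "j' < count_list (ps @ qs) i'" using si' *(4) by simp
  then obtain u where u: "u < length (ps @ qs)" "(ps @ qs) ! u = i'"
    "count_list (drop (Suc u) (ps @ qs)) i' = j'"
    using ex_count_list_drop[of _ "ps @ qs"] by metis
  \<comment> \<open>From position \<open>t\<close> on, \<open>i\<close> fires \<open>j + 1\<close>
    times, but only \<open>j\<close> times within \<open>qs\<close>.\<close>
  have "t < length ps"
  proof (rule ccontr)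
    assume "\<not> t < length ps"
    then have "count_list (drop t (ps @ qs)) i \<le> count_list (drop (length ps) (ps @ qs)) i"
      by (intro count_list_drop_mono) simp
    then show False using count_list_drop_nth[OF t(1)] t(2,3) *(4) by simp
  qed
  moreover have "length ps \<le> u"
  proof (rule ccontr)
    assume "\<not> length ps \<le> u"
    then have "count_list (drop (length ps) (ps @ qs)) i' \<le> count_list (drop (Suc u) (ps @ qs)) i'"
      by (intro count_list_drop_mono) simp
    then show False using u(3) *(4) si' by simp
  qed
  ultimately have "t < u" by simp
  moreover have "occurs_at fs (i, j) t" "occurs_at fs (i', j') u"
    unfolding occurs_at_iff fs(2) len using t u si by simp_all
  ultimately show ?thesis using fs(1) unfolding occurs_after_def by blast
qed

definition moves :: "nat \<Rightarrow> move set" where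
  "moves n = {(i, j). 1 \<le> i \<and> level i + j < n}"

lemma carrier_endgame_poset: "carrier (endgame_poset n) = moves n"
  by (simp add: endgame_poset_def moves_def)

lemma eq_endgame_poset: "eq (endgame_poset n) = (=)"
  by (simp add: endgame_poset_def)

lemma le_endgame_poset_iff:
  assumes "x \<in> moves n" "y \<in> moves n"
  shows "x \<sqsubseteq>\<^bsub>endgame_poset n\<^esub> y \<longleftrightarrow> move_le x y"
proof -
  obtain i j i' j' where xy: "x = (i, j)" "y = (i', j')" by (cases x, cases y) auto
  with assms have "1 \<le> i" "1 \<le> i'" "level i + j < n" "level i' + j' < n" by (auto simp: moves_def)
  then show ?thesis
    using not_occurs_after_if_move_le[of i j i' j' n] occurs_after_if_not_move_le[of i j i' j' n]
    by (auto simp: xy endgame_poset_def simp del: move_le.simps)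
qed

section \<open>Joins and meets\<close>

lemma moves_cases:
  assumes "x \<in> moves n"
  obtains i j where "x = (i, j)" "1 \<le> i" "level i + j < n"
  using assms by (auto simp: moves_def)

lemma move_le_refl: "x \<in> moves n \<Longrightarrow> move_le x x"
  using common_depth_self by (auto simp: moves_def)

lemma move_le_trans:
  assumes "x \<in> moves n" "y \<in> moves n" "z \<in> moves n" "move_le x y" "move_le y z"
  shows "move_le x z"
proof -
  obtain i j where x: "x = (i, j)" "1 \<le> i" using moves_cases[OF assms(1)] .
  obtain i' j' where y: "y = (i', j')" "1 \<le> i'" using moves_cases[OF assms(2)] .
  obtain i'' j'' where z: "z = (i'', j'')" "1 \<le> i''" using moves_cases[OF assms(3)] .
  have "min (common_depth i i') (common_depth i' i'') \<le> common_depth i i''"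
    by (rule common_depth_ultra) (use x y z in auto)
  then show ?thesis
    using assms(4,5) common_depth_facts[OF x(2) y(2)] common_depth_facts[OF y(2) z(2)]
    unfolding x y z move_le.simps by linarith
qed

text \<open>Both levels are at least the common depth, which gives monotonicity; equal ranks force
  both levels to equal it, so that both nodes are their common ancestor.\<close>

lemma endgame_rank_mono:
  assumes "x \<in> moves n" "y \<in> moves n" "move_le x y"
  shows "endgame_rank x \<le> endgame_rank y" "endgame_rank x = endgame_rank y \<Longrightarrow> x = y"
proof -
  obtain i j where x: "x = (i, j)" "1 \<le> i" using moves_cases[OF assms(1)] .
  obtain i' j' where y: "y = (i', j')" "1 \<le> i'" using moves_cases[OF assms(2)] .
  note d = common_depth_facts[OF x(2) y(2)]
  have le: "j + level i \<le> j' + common_depth i i'" using assms(3) by (simp add: x y)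
  show "endgame_rank x \<le> endgame_rank y" using le d by (simp add: x y)
  assume "endgame_rank x = endgame_rank y"
  then have "common_depth i i' = level i" "common_depth i i' = level i'" "j = j'"
    using le d(1,2) by (simp_all add: x y)
  then show "x = y" using d(3) x(1) y(1) ancestor_self by metis
qed

lemma move_le_antisym:
  assumes "x \<in> moves n" "y \<in> moves n" "move_le x y" "move_le y x"
  shows "x = y"
  using endgame_rank_mono[OF assms(1-3)] endgame_rank_mono[OF assms(2,1,4)] by simp

definition is_join :: "nat \<Rightarrow> move \<Rightarrow> move \<Rightarrow> move \<Rightarrow> bool" where
  "is_join n x y z \<longleftrightarrow> z \<in> moves n \<and> move_le x z \<and> move_le y z
     \<and> (\<forall>w\<in>moves n. move_le x w \<longrightarrow> move_le y w \<longrightarrow> move_le z w)"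

definition is_meet :: "nat \<Rightarrow> move \<Rightarrow> move \<Rightarrow> move \<Rightarrow> bool" where
  "is_meet n x y z \<longleftrightarrow> z \<in> moves n \<and> move_le z x \<and> move_le z y
     \<and> (\<forall>w\<in>moves n. move_le w x \<longrightarrow> move_le w y \<longrightarrow> move_le w z)"

lemma is_join_commute: "is_join n x y z \<longleftrightarrow> is_join n y x z"
  by (auto simp: is_join_def)

text \<open>The candidate lies at level \<open>t\<close> on the path from \<open>i\<close> up to the
  common ancestor. Its two parameters are chosen so that the inequalities placing it above
  \<open>(i, j)\<close> and \<open>(i', j')\<close> are both equalities.\<close>

lemma is_join_incomparable:
  assumes "1 \<le> i" "1 \<le> i'" "level i + j < n"
    and "level i' + j' \<le> level i + j" "\<not> move_le (i', j') (i, j)"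
  defines "d \<equiv> common_depth i i'"
  defines "t \<equiv> level i + j + d - (level i' + j')"
  shows "is_join n (i, j) (i', j') (ancestor i t, level i' + j' - d)"
    "endgame_rank (ancestor i t, level i' + j' - d) + d = level i + j + (level i' + j')"
proof -
  define s s' k m where "s = level i + j" and "s' = level i' + j'"
    and "k = ancestor i t" and "m = level i' + j' - d"
  have d: "d \<le> level i" "d \<le> level i'" "1 \<le> d"
    using common_depth_facts[OF assms(1,2)] by (auto simp: d_def)
  \<comment> \<open>Incomparability puts \<open>t\<close> strictly below \<open>level i\<close>,
    while \<open>level i' + j' \<le> level i + j\<close> gives \<open>d \<le> t\<close>.\<close>
  have lt: "j + d < s'"
    using assms(5) by (simp add: d_def s'_def common_depth_commute)
  have t: "d \<le> t" "1 \<le> t" "t \<le> level i" "t + s' = s + d" "m + d = s'"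
    using assms(4) lt d by (auto simp: t_def s_def s'_def m_def)
  have k: "1 \<le> k" "level k = t"
    using ancestor_pos[of i t] level_ancestor[of i t] assms(1) t by (auto simp: k_def)
  have dk: "common_depth k w = min t (common_depth i w)" if "1 \<le> w" for w
    using common_depth_ancestor[OF assms(1) that t(2,3)] by (simp add: k_def)
  have "is_join n (i, j) (i', j') (k, m)"
    unfolding is_join_def
  proof (intro conjI ballI impI)
    have "level k + m = s" using k t by simp
    then show "(k, m) \<in> moves n" using k assms(3) by (simp add: moves_def s_def)
    show "move_le (i, j) (k, m)"
      using dk[OF assms(1)] t common_depth_self[OF assms(1)]
      by (simp add: common_depth_commute[of i k] s_def)
    show "move_le (i', j') (k, m)"
      using dk[OF assms(2)] t by (simp add: common_depth_commute[of i' k] s'_def flip: d_def)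
  next
    fix w assume w: "w \<in> moves n" "move_le (i, j) w" "move_le (i', j') w"
    obtain a b where ab: "w = (a, b)" "1 \<le> a" using moves_cases[OF w(1)] .
    \<comment> \<open>If the path to \<open>a\<close> follows that to \<open>i\<close> beyond depth
      \<open>d\<close>, it meets that to \<open>i'\<close> at depth at most \<open>d\<close>. Then
      \<open>w\<close> lying above \<open>(i', j')\<close> forces \<open>m \<le> b\<close>.\<close>
    have "min (common_depth i a) (common_depth a i') \<le> d"
      unfolding d_def by (rule common_depth_ultra) (use assms ab in auto)
    then show "move_le (k, m) w"
      using w(2,3) dk[OF ab(2)] k t by (simp add: ab common_depth_commute[of a i'] s_def s'_def)
  qed
  then show "is_join n (i, j) (i', j') (ancestor i t, level i' + j' - d)"
    by (simp add: k_def m_def)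
  have "endgame_rank (k, m) + d = s + s'" using k t by simp
  then show "endgame_rank (ancestor i t, level i' + j' - d) + d = level i + j + (level i' + j')"
    by (simp add: k_def m_def s_def s'_def)
qed

lemma ex_join_incomparable:
  assumes "(i, j) \<in> moves n" "(i', j') \<in> moves n"
    and "\<not> move_le (i, j) (i', j')" "\<not> move_le (i', j') (i, j)"
  shows "\<exists>z. is_join n (i, j) (i', j') z
    \<and> endgame_rank z + common_depth i i' = level i + j + (level i' + j')"
proof (cases "level i' + j' \<le> level i + j")
  case True
  then show ?thesis using is_join_incomparable[of i i' j n j'] assms by (auto simp: moves_def)
next
  case False
  then obtain z where "is_join n (i', j') (i, j) z"
    "endgame_rank z + common_depth i' i = level i' + j' + (level i + j)"
    using is_join_incomparable[of i' i j' n j] assms by (auto simp: moves_def)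
  then show ?thesis
    using is_join_commute common_depth_commute[of i i'] by (metis add.commute)
qed

section \<open>Top-bottom flip and meets\<close>

lemma flip_vertical_moves: "x \<in> moves n \<Longrightarrow> flip_vertical n x \<in> moves n"
  by (auto simp: moves_def)

lemma flip_vertical_flip_vertical: "x \<in> moves n \<Longrightarrow> flip_vertical n (flip_vertical n x) = x"
  by (auto simp: moves_def)

text \<open>The flip replaces \<open>level i + j\<close> by \<open>n - 1 - j\<close> and
  \<open>j\<close> by \<open>n - 1 - (level i + j)\<close>, so the two sides of the defining
  inequality trade places.\<close>

lemma move_le_flip_vertical:
  assumes "x \<in> moves n" "y \<in> moves n"
  shows "move_le (flip_vertical n x) (flip_vertical n y) \<longleftrightarrow> move_le y x"
proof -
  obtain i j where x: "x = (i, j)" "1 \<le> i" "level i + j < n" using moves_cases[OF assms(1)] .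
  obtain i' j' where y: "y = (i', j')" "1 \<le> i'" "level i' + j' < n" using moves_cases[OF assms(2)] .
  show ?thesis
    using x y common_depth_facts[OF x(2) y(2)] common_depth_commute[of i i'] by auto
qed

lemma is_meet_flip_vertical:
  assumes "x \<in> moves n" "y \<in> moves n" "is_join n (flip_vertical n x) (flip_vertical n y) z"
  shows "is_meet n x y (flip_vertical n z)"
  unfolding is_meet_def
proof (intro conjI ballI impI)
  let ?F = "flip_vertical n"
  have z: "z \<in> moves n" using assms(3) by (simp add: is_join_def)
  show "?F z \<in> moves n" using z by (rule flip_vertical_moves)
  have rev: "move_le (?F z) u \<longleftrightarrow> move_le (?F u) z" if "u \<in> moves n" for u
    using move_le_flip_vertical[OF z flip_vertical_moves[OF that]] flip_vertical_flip_vertical[OF that] by simp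
  show "move_le (?F z) x" "move_le (?F z) y" using rev assms by (auto simp: is_join_def)
  fix w assume w: "w \<in> moves n" "move_le w x" "move_le w y"
  then have "move_le (?F x) (?F w)" "move_le (?F y) (?F w)"
    using move_le_flip_vertical assms by auto
  then have "move_le z (?F w)" using assms(3) flip_vertical_moves[OF w(1)] by (simp add: is_join_def)
  then show "move_le w (?F z)"
    using move_le_flip_vertical[OF flip_vertical_moves[OF w(1)] z] flip_vertical_flip_vertical[OF w(1)]
    by simp
qed

lemma endgame_rank_flip_vertical:
  "x \<in> moves n \<Longrightarrow> endgame_rank (flip_vertical n x) + endgame_rank x = 2 * (n - 1)"
  by (auto simp: moves_def)

lemma ex_join_meet:
  assumes x: "x \<in> moves n" and y: "y \<in> moves n"
  shows "\<exists>z w. is_join n x y z \<and> is_meet n x y w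
    \<and> endgame_rank z + endgame_rank w = endgame_rank x + endgame_rank y"
proof -
  consider "move_le x y" | "move_le y x" | "\<not> move_le x y" "\<not> move_le y x" by blast
  then show ?thesis
  proof cases
    case 1
    then have "is_join n x y y" "is_meet n x y x" using x y move_le_refl by (auto simp: is_join_def is_meet_def)
    then show ?thesis by (intro exI[of _ y] exI[of _ x]) simp
  next
    case 2
    then have "is_join n x y x" "is_meet n x y y" using x y move_le_refl by (auto simp: is_join_def is_meet_def)
    then show ?thesis by (intro exI[of _ x] exI[of _ y]) simp
  next
    case 3
    let ?F = "flip_vertical n"
    obtain i j where ij: "x = (i, j)" "1 \<le> i" "level i + j < n" using moves_cases[OF x] .
    obtain i' j' where ij': "y = (i', j')" "1 \<le> i'" "level i' + j' < n" using moves_cases[OF y] .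
    obtain z where z: "is_join n x y z"
      "endgame_rank z + common_depth i i' = level i + j + (level i' + j')"
      using ex_join_incomparable[of i j n i' j'] x y 3 ij ij' by auto
    have "\<not> move_le (?F x) (?F y)" "\<not> move_le (?F y) (?F x)"
      using move_le_flip_vertical x y 3 by auto
    \<comment> \<open>In flipped coordinates \<open>level + j\<close> is \<open>n - 1\<close> minus
      the old second component. Flipping back gives the meet rank
      \<open>j + j' + common_depth i i'\<close>, whose last term cancels against the join.\<close>
    then obtain w where w: "is_join n (?F x) (?F y) w"
      "endgame_rank w + common_depth i i' = (n - 1 - j) + (n - 1 - j')"
      using ex_join_incomparable[of i "n - 1 - level i - j" n i' "n - 1 - level i' - j'"]
        flip_vertical_moves[OF x] flip_vertical_moves[OF y] ij ij' by auto
    have "w \<in> moves n" using w(1) by (simp add: is_join_def)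
    from endgame_rank_flip_vertical[OF this] w(2) z(2)
    have "endgame_rank z + endgame_rank (?F w) = endgame_rank x + endgame_rank y"
      using ij ij' by simp
    then show ?thesis using z(1) is_meet_flip_vertical[OF x y w(1)] by blast
  qed
qed

text \<open>One step from \<open>x\<close> towards \<open>y\<close>: up to the parent with
  \<open>j + 1\<close>, or down towards \<open>i'\<close> with \<open>j\<close> kept, or, on the
  same node, to a child with \<open>j\<close> kept. Each raises the rank by 1, so covers do
  too.\<close>

lemma ex_rank_successor:
  assumes "x \<in> moves n" "y \<in> moves n" "move_le x y" "x \<noteq> y"
  shows "\<exists>z\<in>moves n. move_le x z \<and> move_le z y \<and> endgame_rank z = endgame_rank x + 1"
proof -
  obtain i j where x: "x = (i, j)" "1 \<le> i" "level i + j < n" using moves_cases[OF assms(1)] .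
  obtain i' j' where y: "y = (i', j')" "1 \<le> i'" "level i' + j' < n" using moves_cases[OF assms(2)] .
  note d = common_depth_facts[OF x(2) y(2)]
  have le: "j + level i \<le> j' + common_depth i i'" using assms(3) by (simp add: x y)
  consider "common_depth i i' < level i" | "common_depth i i' = level i" "level i < level i'"
    | "common_depth i i' = level i" "level i = level i'"
    using d by linarith
  then show ?thesis
  proof cases
    case 1
    define p where "p = ancestor i (level i - 1)"
    have l: "1 \<le> level i - 1" "level i - 1 \<le> level i" using 1 d by auto
    have "1 \<le> p" "level i = Suc (level p)"
      using ancestor_pos[OF x(2) l] level_ancestor[OF x(2) l] l by (auto simp: p_def)
    moreover have "common_depth i p = level p" "common_depth p i' = common_depth i i'"
      using common_depth_ancestor[OF x(2) x(2) l] common_depth_ancestor[OF x(2) y(2) l]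
        level_ancestor[OF x(2) l] common_depth_self[OF x(2)] 1 common_depth_commute[of i p]
      by (auto simp: p_def)
    ultimately show ?thesis
      using x y le by (intro bexI[of _ "(p, j + 1)"]) (auto simp: moves_def)
  next
    case 2
    let ?c = "ancestor i' (level i + 1)"
    have l: "1 \<le> level i + 1" "level i + 1 \<le> level i'" using 2 by auto
    have c: "1 \<le> ?c" "level ?c = level i + 1"
      using ancestor_pos[OF y(2) l] level_ancestor[OF y(2) l] by auto
    have "common_depth ?c i = level i" "common_depth ?c i' = level i + 1"
      using common_depth_ancestor[OF y(2) x(2) l] common_depth_ancestor[OF y(2) y(2) l]
        common_depth_self[OF y(2)] 2 common_depth_commute[of i' i] by auto
    then show ?thesis
      using c l x y le 2 common_depth_commute[of i ?c]
      by (intro bexI[of _ "(?c, j)"]) (auto simp: moves_def)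
  next
    case 3
    then have "i = i'" using d(3) ancestor_self by metis
    then have j: "j < j'" using le 3 assms(4) x y by auto
    have c: "2 \<le> 2 * i" "level (2 * i) = level i + 1" using x(2) level_double(1)[of i] by auto
    have "common_depth i (2 * i) = level i"
      using common_depth_half[OF x(2) c(1)] common_depth_self[OF x(2)]
        common_depth_facts(1)[of i "2 * i"] x(2) c(2) by simp
    then show ?thesis
      using c x y j \<open>i = i'\<close> common_depth_commute[of "2 * i" i]
      by (intro bexI[of _ "(2 * i, j)"]) (auto simp: moves_def)
  qed
qed

section \<open>Left-right flip of moves\<close>

lemma flip_horizontal_eq_mirror: "flip_horizontal (i, j) = (mirror i, j)"
  by (simp add: mirror_def)

lemma flip_horizontal_moves: "x \<in> moves n \<Longrightarrow> flip_horizontal x \<in> moves n"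
  by (auto simp: moves_def flip_horizontal_eq_mirror level_mirror mirror_pos
      simp del: flip_horizontal.simps One_nat_def)

lemma flip_horizontal_flip_horizontal: "x \<in> moves n \<Longrightarrow> flip_horizontal (flip_horizontal x) = x"
  by (auto simp: moves_def flip_horizontal_eq_mirror mirror_mirror
      simp del: flip_horizontal.simps One_nat_def)

lemma move_le_flip_horizontal:
  "x \<in> moves n \<Longrightarrow> y \<in> moves n \<Longrightarrow>
    move_le (flip_horizontal x) (flip_horizontal y) \<longleftrightarrow> move_le x y"
  by (auto simp: moves_def flip_horizontal_eq_mirror level_mirror common_depth_mirror
      simp del: flip_horizontal.simps One_nat_def)

lemma bij_betw_involution:
  assumes "\<And>x. x \<in> A \<Longrightarrow> f x \<in> A" "\<And>x. x \<in> A \<Longrightarrow> f (f x) = x"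
  shows "bij_betw f A A"
  by (rule bij_betwI[where g = f]) (use assms in auto)

text \<open>The two sides of the modular law are comparable and have the same meet and the same join
  with \<open>y\<close>. The rank identity gives them equal rank, and comparable elements of equal
  rank coincide.\<close>

lemma (in lattice) modular_if_rank_modular:
  fixes \<rho> :: "'a \<Rightarrow> nat"
  assumes mono: "\<And>x y. x \<in> carrier L \<Longrightarrow> y \<in> carrier L \<Longrightarrow> x \<sqsubseteq> y \<Longrightarrow> \<rho> x = \<rho> y \<Longrightarrow> x = y"
    and rank: "\<And>x y. x \<in> carrier L \<Longrightarrow> y \<in> carrier L \<Longrightarrow> \<rho> x + \<rho> y = \<rho> (x \<squnion> y) + \<rho> (x \<sqinter> y)"
  shows "modular_lattice L"
  unfolding modular_lattice_def
proof (intro conjI ballI impI)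
  show "lattice L" by (rule lattice_axioms)
  fix x y z assume c [simp]: "x \<in> carrier L" "y \<in> carrier L" "z \<in> carrier L" and xz: "x \<sqsubseteq> z"
  let ?u = "x \<squnion> (y \<sqinter> z)" and ?v = "(x \<squnion> y) \<sqinter> z"
  have [simp]: "y \<sqinter> z \<in> carrier L" "x \<squnion> y \<in> carrier L" "?u \<in> carrier L" "?v \<in> carrier L"
    "?u \<sqinter> y \<in> carrier L" "?v \<sqinter> y \<in> carrier L" "?u \<squnion> y \<in> carrier L" "?v \<squnion> y \<in> carrier L"
    by simp_all
  have yz: "y \<sqinter> z \<sqsubseteq> y" "y \<sqinter> z \<sqsubseteq> z" by (simp_all add: meet_left meet_right)
  have xy: "x \<sqsubseteq> x \<squnion> y" "y \<sqsubseteq> x \<squnion> y" by (simp_all add: join_left join_right)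
  have u: "x \<sqsubseteq> ?u" "y \<sqinter> z \<sqsubseteq> ?u" by (simp_all add: join_left join_right)
  have v: "?v \<sqsubseteq> x \<squnion> y" "?v \<sqsubseteq> z" by (simp_all add: meet_left meet_right)
  have uv: "?u \<sqsubseteq> ?v"
  proof (rule join_le)
    show "x \<sqsubseteq> ?v" using xz xy by (intro meet_le) simp_all
    have "y \<sqinter> z \<sqsubseteq> x \<squnion> y" by (rule le_trans[OF yz(1) xy(2)]) simp_all
    then show "y \<sqinter> z \<sqsubseteq> ?v" using yz by (intro meet_le) simp_all
  qed simp_all
  have "?u \<sqinter> y = ?v \<sqinter> y"
  proof (rule le_antisym)
    show "?u \<sqinter> y \<sqsubseteq> ?v \<sqinter> y"
    proof (rule meet_le)
      show "?u \<sqinter> y \<sqsubseteq> ?v" by (rule le_trans[OF meet_left uv]) simp_all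
      show "?u \<sqinter> y \<sqsubseteq> y" by (simp add: meet_right)
    qed simp_all
    show "?v \<sqinter> y \<sqsubseteq> ?u \<sqinter> y"
    proof (rule meet_le)
      have "?v \<sqinter> y \<sqsubseteq> y \<sqinter> z"
      proof (rule meet_le)
        show "?v \<sqinter> y \<sqsubseteq> y" by (simp add: meet_right)
        show "?v \<sqinter> y \<sqsubseteq> z" by (rule le_trans[OF meet_left v(2)]) simp_all
      qed simp_all
      then show "?v \<sqinter> y \<sqsubseteq> ?u" by (rule le_trans[OF _ u(2)]) simp_all
      show "?v \<sqinter> y \<sqsubseteq> y" by (simp add: meet_right)
    qed simp_all
  qed simp_all
  moreover have "?u \<squnion> y = ?v \<squnion> y"
  proof (rule le_antisym)
    show "?u \<squnion> y \<sqsubseteq> ?v \<squnion> y"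
    proof (rule join_le)
      show "?u \<sqsubseteq> ?v \<squnion> y" by (rule le_trans[OF uv join_left]) simp_all
      show "y \<sqsubseteq> ?v \<squnion> y" by (simp add: join_right)
    qed simp_all
    show "?v \<squnion> y \<sqsubseteq> ?u \<squnion> y"
    proof (rule join_le)
      have "x \<squnion> y \<sqsubseteq> ?u \<squnion> y"
      proof (rule join_le)
        show "x \<sqsubseteq> ?u \<squnion> y" by (rule le_trans[OF u(1) join_left]) simp_all
        show "y \<sqsubseteq> ?u \<squnion> y" by (simp add: join_right)
      qed simp_all
      then show "?v \<sqsubseteq> ?u \<squnion> y" by (rule le_trans[OF v(1)]) simp_all
      show "y \<sqsubseteq> ?u \<squnion> y" by (simp add: join_right)
    qed simp_all
  qed simp_all
  ultimately have "\<rho> ?u = \<rho> ?v" using rank[of ?u y] rank[of ?v y] by simp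
  then show "?u = ?v" using mono uv by simp
qed

section \<open>The lattice structure of the endgame poset\<close>

lemma least_Upper_iff_is_join:
  assumes "x \<in> moves n" "y \<in> moves n"
  shows "least (endgame_poset n) z (Upper (endgame_poset n) {x, y}) \<longleftrightarrow> is_join n x y z"
  using assms
  by (auto simp: least_def Upper_def is_join_def carrier_endgame_poset le_endgame_poset_iff
      simp del: split_paired_All)

lemma greatest_Lower_iff_is_meet:
  assumes "x \<in> moves n" "y \<in> moves n"
  shows "greatest (endgame_poset n) z (Lower (endgame_poset n) {x, y}) \<longleftrightarrow> is_meet n x y z"
  using assms
  by (auto simp: greatest_def Lower_def is_meet_def carrier_endgame_poset le_endgame_poset_iff
      simp del: split_paired_All)

lemma partial_order_endgame_poset: "partial_order (endgame_poset n)"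
  by unfold_locales
    (simp_all add: carrier_endgame_poset eq_endgame_poset le_endgame_poset_iff,
      (blast intro: move_le_refl move_le_antisym move_le_trans)+)

lemma lattice_endgame_poset: "lattice (endgame_poset n)"
proof -
  interpret partial_order "endgame_poset n" by (rule partial_order_endgame_poset)
  show ?thesis
    using ex_join_meet
    by unfold_locales (simp_all add: carrier_endgame_poset least_Upper_iff_is_join
        greatest_Lower_iff_is_meet, blast+)
qed

lemma is_join_unique: "is_join n x y z \<Longrightarrow> is_join n x y z' \<Longrightarrow> z = z'"
  unfolding is_join_def by (blast intro: move_le_antisym)

lemma is_meet_unique: "is_meet n x y z \<Longrightarrow> is_meet n x y z' \<Longrightarrow> z = z'"
  unfolding is_meet_def by (blast intro: move_le_antisym)

lemma endgame_rank_modular: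
  assumes "x \<in> moves n" "y \<in> moves n"
  shows "endgame_rank x + endgame_rank y
    = endgame_rank (x \<squnion>\<^bsub>endgame_poset n\<^esub> y) + endgame_rank (x \<sqinter>\<^bsub>endgame_poset n\<^esub> y)"
proof -
  interpret lattice "endgame_poset n" by (rule lattice_endgame_poset)
  have "is_join n x y (x \<squnion>\<^bsub>endgame_poset n\<^esub> y)" "is_meet n x y (x \<sqinter>\<^bsub>endgame_poset n\<^esub> y)"
    using sup_of_two_least[of x y] inf_of_two_greatest[of x y] assms
    by (simp_all add: join_def meet_def carrier_endgame_poset least_Upper_iff_is_join
        greatest_Lower_iff_is_meet)
  then show ?thesis using ex_join_meet[OF assms] is_join_unique is_meet_unique by metis
qed

lemma lless_endgame_poset_iff:
  "x \<in> moves n \<Longrightarrow> y \<in> moves n \<Longrightarrow> x \<sqsubset>\<^bsub>endgame_poset n\<^esub> y \<longleftrightarrow> move_le x y \<and> x \<noteq> y"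
  by (simp add: lless_def eq_endgame_poset le_endgame_poset_iff)

lemma rank_function_endgame_rank: "rank_function (endgame_poset n) endgame_rank"
  unfolding rank_function_def carrier_endgame_poset
proof (intro conjI ballI impI allI)
  fix x y assume "x \<in> moves n" "y \<in> moves n" "x \<sqsubset>\<^bsub>endgame_poset n\<^esub> y"
  then show "endgame_rank x < endgame_rank y"
    using endgame_rank_mono[of x n y] by (auto simp: lless_endgame_poset_iff le_less)
next
  fix x y assume cov: "covered_by (endgame_poset n) x y"
  then have xy: "x \<in> moves n" "y \<in> moves n" "move_le x y" "x \<noteq> y"
    by (auto simp: covered_by_def carrier_endgame_poset lless_endgame_poset_iff)
  obtain z where z: "z \<in> moves n" "move_le x z" "move_le z y" "endgame_rank z = endgame_rank x + 1"
    using ex_rank_successor[OF xy] by blast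
  have "x \<noteq> z" using z(4) by auto
  \<comment> \<open>Nothing lies strictly between \<open>x\<close> and its cover \<open>y\<close>,
    so the rank successor is \<open>y\<close> itself.\<close>
  then have "z = y"
    using cov z xy by (auto simp: covered_by_def carrier_endgame_poset lless_endgame_poset_iff)
  then show "endgame_rank y = endgame_rank x + 1" using z(4) by simp
qed

theorem theorem6p3:
  fixes n :: nat
  assumes "n \<ge> 2"
  shows "modular_lattice (endgame_poset n)
    \<and> rank_function (endgame_poset n) endgame_rank
    \<and> (\<forall>x \<in> carrier (endgame_poset n). \<forall>y \<in> carrier (endgame_poset n).
          endgame_rank x + endgame_rank y
          = endgame_rank (x \<squnion>\<^bsub>endgame_poset n\<^esub> y) + endgame_rank (x \<sqinter>\<^bsub>endgame_poset n\<^esub> y))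
    \<and> order_automorphism (endgame_poset n) flip_horizontal
    \<and> order_anti_automorphism (endgame_poset n) (flip_vertical n)"
proof (intro conjI)
  show "modular_lattice (endgame_poset n)"
    by (rule lattice.modular_if_rank_modular[OF lattice_endgame_poset, of n endgame_rank])
      (simp_all add: carrier_endgame_poset le_endgame_poset_iff endgame_rank_modular,
        blast intro: endgame_rank_mono(2))
  show "\<forall>x \<in> carrier (endgame_poset n). \<forall>y \<in> carrier (endgame_poset n).
          endgame_rank x + endgame_rank y
          = endgame_rank (x \<squnion>\<^bsub>endgame_poset n\<^esub> y) + endgame_rank (x \<sqinter>\<^bsub>endgame_poset n\<^esub> y)"
    by (simp add: carrier_endgame_poset endgame_rank_modular)
  show "order_automorphism (endgame_poset n) flip_horizontal"
    unfolding order_automorphism_def carrier_endgame_poset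
    using bij_betw_involution[of "moves n" flip_horizontal] flip_horizontal_moves
      flip_horizontal_flip_horizontal move_le_flip_horizontal le_endgame_poset_iff by metis
  show "order_anti_automorphism (endgame_poset n) (flip_vertical n)"
    unfolding order_anti_automorphism_def carrier_endgame_poset
    using bij_betw_involution[of "moves n" "flip_vertical n"] flip_vertical_moves
      flip_vertical_flip_vertical move_le_flip_vertical le_endgame_poset_iff by metis
qed (rule rank_function_endgame_rank)

end
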